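(* In the setting below, let $\vartheta^*$ be the optimal value of $\min_{u\in U}G(u)$ and, for each $N$, let $u_N^*:\Omega\to U$ be a measurable map such that $u_N^*(\omega)$ solves the SAA problem $\min_{u\in U}\hat F_N(Bu,\omega)+\psi(u)$ for every $\omega$. Then (i) $\hat\vartheta_N^*\to\vartheta^*$ as $N\to\infty$ with probability one, and (ii) for almost all $\omega\in\Omega$, the sequence $(u_N^*(\omega))$ has at least one weak accumulation point in $U$, and every such point is a solution of $\min_{u\in U}G(u)$.
   Context: Let $U$ be a separable Hilbert space (identified with its dual), $W$ a separable Banach space, and $B:U\to W$ a compact linear operator. Let $\psi:U\to[0,\infty]$ be proper, closed and convex with bounded domain $\mathcal D(\psi)=\{u\in U:\psi(u)<\infty\}$. Let $U_0\subset U$ be open, convex and bounded with $\mathcal D(\psi)\subset U_0$. Let $\Xi$ be a complete separable metric space (with Borel $\sigma$-field), $\boldsymbol\xi$ a $\Xi$-valued random element, and $\boldsymbol\xi^1,\boldsymbol\xi^2,\ldots$ independent $\Xi$-valued random elements defined on a complete probability space $(\Omega,\mathcal F,P)$, each having the distribution of $\boldsymbol\xi$. Let $f:B(U_0)\times\Xi\to\mathbb R$ be such that $f(\cdot,\xi)$ is continuous on $B(\mathcal D(\psi))$ for each $\xi\in\Xi$, $f(w,\cdot)$ is measurable for each $w\in B(U_0)$, and $|f(Bu,\xi)|\le \zeta_f(\xi)$ for all $(u,\xi)\in U_0\times\Xi$, where $\zeta_f:\Xi\to[0,\infty)$ is integrable. Set $F(w)=\mathbb E[f(w,\boldsymbol\xi)]$,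 $G(u)=F(Bu)+\psi(u)$, $\hat F_N(w,\omega)=\frac1N\sum_{i=1}^N f(w,\boldsymbol\xi^i(\omega))$, and let $\hat\vartheta_N^*(\omega)$ denote the optimal value of the SAA problem $\min_{u\in U}\hat F_N(Bu,\omega)+\psi(u)$. *)

theory Defs
  imports "HOL-Analysis.Analysis" "HOL-Probability.Probability"
begin

definition compact_operator :: "('a::real_normed_vector \<Rightarrow> 'b::real_normed_vector) \<Rightarrow> bool" where
  "compact_operator B \<longleftrightarrow> bounded_linear B \<and>
     (\<forall>S. bounded S \<longrightarrow> compact (closure (B ` S)))"

definition epigraph :: "('a \<Rightarrow> ereal) \<Rightarrow> ('a \<times> real) set" where
  "epigraph \<psi> = {(u, t). \<psi> u \<le> ereal t}"

definition effdom :: "('a \<Rightarrow> ereal) \<Rightarrow> 'a set" where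
  "effdom \<psi> = {u. \<psi> u < \<infinity>}"

definition proper_fun :: "('a \<Rightarrow> ereal) \<Rightarrow> bool" where
  "proper_fun \<psi> \<longleftrightarrow> (\<forall>u. \<psi> u > -\<infinity>) \<and> (\<exists>u. \<psi> u < \<infinity>)"

definition closed_fun :: "('a::topological_space \<Rightarrow> ereal) \<Rightarrow> bool" where
  "closed_fun \<psi> \<longleftrightarrow> closed (epigraph \<psi>)"

definition convex_fun :: "('a::real_vector \<Rightarrow> ereal) \<Rightarrow> bool" where
  "convex_fun \<psi> \<longleftrightarrow> convex (epigraph \<psi>)"

definition weakly_converges :: "(nat \<Rightarrow> 'a::real_inner) \<Rightarrow> 'a \<Rightarrow> bool" where
  "weakly_converges x u \<longleftrightarrow> (\<forall>v. (\<lambda>n. x n \<bullet> v) \<longlonglongrightarrow> u \<bullet> v)"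

definition weak_accumulation_point :: "(nat \<Rightarrow> 'a::real_inner) \<Rightarrow> 'a \<Rightarrow> bool" where
  "weak_accumulation_point x u \<longleftrightarrow> (\<exists>r. strict_mono r \<and> weakly_converges (x \<circ> r) u)"

end

theory Submission
  imports Defs "HOL-Complex_Analysis.Great_Picard"
begin

text \<open>
  Almost surely the strong law holds simultaneously for the dominating function \<open>\<zeta>\<close>, for \<open>f (B v\<^sub>k)\<close> along a
  minimising sequence \<open>v\<^sub>k\<close> of \<open>G\<close>, and for the functions \<open>INF w \<in> V \<inter> B(dom \<psi>). f w\<close> with \<open>V\<close> in a countable
  base of the topology. For such \<open>\<omega>\<close>, the law for \<open>\<zeta>\<close> confines the SAA solutions eventually to a sublevel set
  of \<open>\<psi>\<close>, hence to a weakly sequentially compact set. If they converge weakly to \<open>u\<close> along a subsequence,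
  then their images under the compact operator \<open>B\<close> converge in norm, so the infimum functions give
  \<open>F(B u) \<le> liminf\<close> of the empirical means, and weak lower semicontinuity of \<open>\<psi>\<close> gives \<open>G(u) \<le> liminf\<close> of the
  SAA values. The law along \<open>v\<^sub>k\<close> bounds the limsup of the SAA values by \<open>inf G\<close>.
\<close>

section \<open>Weak convergence in Hilbert spaces\<close>

text \<open>Elements of almost minimal norm, one from each \<open>C n\<close>, form a Cauchy
  sequence by the parallelogram law, because the minimal norms increase to a finite limit. A
  constant family gives the projection of the origin onto a closed convex set; a decreasing family
  gives a common point, which replaces an appeal to weak compactness.\<close>

lemma nested_convex_least_norm_point:
  fixes C :: "nat \<Rightarrow> 'a::{real_inner, complete_space} set"
  assumes cl: "\<And>n. closed (C n)" and co: "\<And>n. convex (C n)" and dec: "decseq C"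
    and bd: "\<And>n. \<exists>y\<in>C n. norm y \<le> R"
  obtains p where "\<And>n. p \<in> C n" "\<And>r. (\<And>n. \<exists>y\<in>C n. norm y \<le> r) \<Longrightarrow> norm p \<le> r"
proof -
  define d where "d n = Inf (norm ` C n)" for n
  have ne: "C n \<noteq> {}" for n using bd[of n] by auto
  have bb: "bdd_below (norm ` C n)" for n by (rule bdd_belowI[of _ 0]) auto
  have d_le: "d n \<le> norm y" if "y \<in> C n" for n y
    unfolding d_def by (rule cInf_lower) (use that bb in auto)
  have d0: "0 \<le> d n" for n
    unfolding d_def by (rule cInf_greatest) (use ne in auto)
  have d_inc: "d n \<le> d m" if "n \<le> m" for n m
    unfolding d_def using decseqD[OF dec that] ne[of m] bb
    by (intro cInf_superset_mono) auto
  have dR: "d n \<le> R" for n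
    using bd[of n] d_le order_trans by blast
  obtain D where D: "d \<longlonglongrightarrow> D" and dD: "\<And>n. d n \<le> D"
    using incseq_convergent[of d R] d_inc dR by (auto simp: incseq_def)
  have "\<exists>x. x \<in> C n \<and> norm x < d n + 1 / Suc n" for n
  proof -
    have "Inf (norm ` C n) < d n + 1 / Suc n" by (simp add: d_def)
    then show ?thesis using cInf_lessD[of "norm ` C n"] ne[of n] by blast
  qed
  then obtain x where xC: "\<And>n. x n \<in> C n" and xn: "\<And>n. norm (x n) < d n + 1 / Suc n"
    by metis
  \<comment> \<open>By the parallelogram law the squared distance of \<open>x m\<close> and
    \<open>x n\<close> is twice the sum of their squared norms minus the squared norm of their sum.
    Both norms are at most \<open>D + 1 / Suc n\<close>, and the midpoint lies in
    \<open>C n\<close>, so the sum has norm at least \<open>2 * d n\<close>.\<close>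
  define e where "e n = 4 * (D + 1 / Suc n)\<^sup>2 - 4 * (d n)\<^sup>2" for n
  have "e \<longlonglongrightarrow> 4 * (D + 0)\<^sup>2 - 4 * D\<^sup>2"
    unfolding e_def by (intro tendsto_intros D LIMSEQ_Suc[OF lim_1_over_n])
  then have e0: "e \<longlonglongrightarrow> 0" by simp
  have key: "(norm (x m - x n))\<^sup>2 \<le> e n" if "n \<le> m" for m n
  proof -
    have "x m \<in> C n" using decseqD[OF dec that] xC by blast
    then have "(1/2) *\<^sub>R x m + (1/2) *\<^sub>R x n \<in> C n"
      using co[of n] xC[of n] by (intro convexD) auto
    then have "d n \<le> norm ((1/2) *\<^sub>R (x m + x n))" by (metis d_le scaleR_add_right)
    then have "2 * d n \<le> norm (x m + x n)" by simp
    then have "(2 * d n)\<^sup>2 \<le> (norm (x m + x n))\<^sup>2" by (intro power_mono) (use d0 in auto)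
    moreover have "(norm (x m + x n))\<^sup>2 + (norm (x m - x n))\<^sup>2 = 2 * (norm (x m))\<^sup>2 + 2 * (norm (x n))\<^sup>2"
      by (simp add: power2_norm_eq_inner inner_simps inner_commute)
    moreover have "(norm (x m))\<^sup>2 \<le> (D + 1 / Suc n)\<^sup>2"
    proof (intro power_mono)
      have "1 / real (Suc m) \<le> 1 / real (Suc n)" using that by (simp add: frac_le)
      then show "norm (x m) \<le> D + 1 / real (Suc n)" using xn[of m] dD[of m] by linarith
    qed auto
    moreover have "(norm (x n))\<^sup>2 \<le> (D + 1 / Suc n)\<^sup>2"
      by (intro power_mono) (use xn[of n] dD[of n] in auto)
    ultimately show ?thesis unfolding e_def by (simp add: power_mult_distrib)
  qed
  have "Cauchy x"
  proof (rule CauchyI)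
    fix \<epsilon> :: real assume "\<epsilon> > 0"
    then have "\<forall>\<^sub>F n in sequentially. e n < (\<epsilon>/2)\<^sup>2"
      using order_tendstoD(2)[OF e0, of "(\<epsilon>/2)\<^sup>2"] by simp
    then obtain K where K: "e K < (\<epsilon>/2)\<^sup>2" by (auto simp: eventually_sequentially)
    have near: "norm (x m - x K) < \<epsilon>/2" if "K \<le> m" for m
      using key[OF that] K \<open>\<epsilon> > 0\<close> by (intro power2_less_imp_less[of _ "\<epsilon>/2"]) auto
    have "norm (x m - x n) < \<epsilon>" if "K \<le> m" "K \<le> n" for m n
      using near[OF that(1)] near[OF that(2)] norm_triangle_ineq4[of "x m - x K" "x n - x K"] by simp
    then show "\<exists>M. \<forall>m\<ge>M. \<forall>n\<ge>M. norm (x m - x n) < \<epsilon>" by blast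
  qed
  then obtain p where p: "x \<longlonglongrightarrow> p"
    using Cauchy_convergent_iff convergent_def by blast
  show thesis
  proof
    show "p \<in> C n" for n
    proof (rule Lim_in_closed_set[OF cl _ _ p])
      show "\<forall>\<^sub>F k in sequentially. x k \<in> C n"
        using decseqD[OF dec] xC by (auto simp: eventually_sequentially intro!: exI[of _ n])
    qed auto
    fix r assume r: "\<And>n. \<exists>y\<in>C n. norm y \<le> r"
    have "d n \<le> r" for n using r[of n] d_le order_trans by blast
    then have "D \<le> r" by (intro LIMSEQ_le_const2[OF D]) auto
    moreover have "norm p \<le> D + 0"
    proof (rule LIMSEQ_le[OF tendsto_norm[OF p]])
      show "(\<lambda>n. D + 1 / Suc n) \<longlonglongrightarrow> D + 0"
        by (intro tendsto_intros LIMSEQ_Suc[OF lim_1_over_n])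
      show "\<exists>N. \<forall>n\<ge>N. norm (x n) \<le> D + 1 / Suc n"
        using xn dD by (meson add_le_cancel_right less_imp_le order_trans)
    qed
    ultimately show "norm p \<le> r" by simp
  qed
qed

text \<open>Mazur's theorem. After translating \<open>u\<close> to the origin, the point
  \<open>p\<close> of least norm satisfies \<open>p \<bullet> p \<le> y \<bullet> p\<close> on the
  whole translated set; weak convergence tested against \<open>p\<close> then forces
  \<open>p = 0\<close>. Membership of \<open>x n\<close> for infinitely many \<open>n\<close>
  suffices, which is the form that lower semicontinuity calls for.\<close>

lemma weak_limit_in_closed_convex:
  fixes C :: "'a::{real_inner, complete_space} set"
  assumes cl: "closed C" and co: "convex C"
    and x: "\<exists>\<^sub>F n in sequentially. x n \<in> C" and u: "weakly_converges x u"
  shows "u \<in> C"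
proof -
  define C' where "C' = (\<lambda>y. y - u) ` C"
  obtain k where "x k \<in> C" using frequently_ex[OF x] by blast
  then have ne: "x k - u \<in> C'" by (auto simp: C'_def)
  have cl': "closed C'" unfolding C'_def using closed_translation_subtract[OF cl] by blast
  have co': "convex C'" unfolding C'_def by (rule convex_translation_subtract[OF co])
  obtain p where p: "p \<in> C'" and least: "\<And>r. (\<exists>y\<in>C'. norm y \<le> r) \<Longrightarrow> norm p \<le> r"
    using nested_convex_least_norm_point[of "\<lambda>_. C'" "norm (x k - u)"] cl' co' ne by (auto simp: decseq_def)
  have var: "p \<bullet> p \<le> y \<bullet> p" if y: "y \<in> C'" for y
  proof (rule ccontr)
    assume "\<not> ?thesis"
    then have neg: "(y - p) \<bullet> p < 0" by (simp add: inner_simps)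
    define q where "q = (norm (y - p))\<^sup>2"
    have "y \<noteq> p" using neg by auto
    then have q: "q > 0" by (simp add: q_def)
    \<comment> \<open>This is the minimiser over the unit interval of the quadratic giving the
      squared norm at a point of the segment from \<open>p\<close> to \<open>y\<close>. If
      \<open>(y - p) \<bullet> p\<close> were negative, the norm there would drop strictly below
      that of \<open>p\<close>.\<close>
    define t where "t = min 1 (- ((y - p) \<bullet> p) / q)"
    have t: "0 < t" "t \<le> 1" using divide_neg_pos[OF neg q] by (auto simp: t_def)
    have tq: "t * q \<le> - ((y - p) \<bullet> p)"
      using q by (simp add: t_def min_def field_simps)
    have "(1 - t) *\<^sub>R p + t *\<^sub>R y \<in> C'" using co' p y t by (intro convexD) auto
    then have "norm p \<le> norm (p + t *\<^sub>R (y - p))"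
      by (intro least bexI[of _ "p + t *\<^sub>R (y - p)"]) (auto simp: algebra_simps)
    then have "(norm p)\<^sup>2 \<le> (norm (p + t *\<^sub>R (y - p)))\<^sup>2" by (intro power_mono) auto
    also have "\<dots> = (norm p)\<^sup>2 + 2 * t * ((y - p) \<bullet> p) + t * (t * q)"
      by (simp add: q_def power2_norm_eq_inner inner_simps inner_commute algebra_simps)
    also have "\<dots> \<le> (norm p)\<^sup>2 + 2 * t * ((y - p) \<bullet> p) + t * - ((y - p) \<bullet> p)"
      using tq t by (intro add_left_mono mult_left_mono) auto
    finally have "0 \<le> t * ((y - p) \<bullet> p)" by simp
    then show False using t neg by (simp add: zero_le_mult_iff)
  qed
  have "(\<lambda>n. x n \<bullet> p - u \<bullet> p) \<longlonglongrightarrow> u \<bullet> p - u \<bullet> p"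
    using u by (intro tendsto_diff tendsto_const) (auto simp: weakly_converges_def)
  then have lim: "(\<lambda>n. (x n - u) \<bullet> p) \<longlonglongrightarrow> 0" by (simp add: inner_simps)
  have "p = 0"
  proof (rule ccontr)
    assume "p \<noteq> 0"
    then have "\<forall>\<^sub>F n in sequentially. (x n - u) \<bullet> p < p \<bullet> p"
      using order_tendstoD(2)[OF lim] by simp
    with x have "\<exists>\<^sub>F n in sequentially. x n \<in> C \<and> (x n - u) \<bullet> p < p \<bullet> p"
      by (rule frequently_eventually_frequently)
    then obtain n where "x n \<in> C" "(x n - u) \<bullet> p < p \<bullet> p" using frequently_ex by blast
    then show False using var[of "x n - u"] by (auto simp: C'_def)
  qed
  then show ?thesis using p by (auto simp: C'_def)
qed

lemma convergent_inner_of_dense: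
  fixes y :: "nat \<Rightarrow> 'a::real_inner"
  assumes R: "\<And>n. norm (y n) \<le> R"
    and D: "\<And>U. open U \<Longrightarrow> U \<noteq> {} \<Longrightarrow> \<exists>d\<in>D. d \<in> U"
    and conv: "\<And>d. d \<in> D \<Longrightarrow> convergent (\<lambda>n. y n \<bullet> d)"
  shows "convergent (\<lambda>n. y n \<bullet> v)"
proof -
  have R0: "R \<ge> 0" using R[of 0] norm_ge_zero order_trans by blast
  have "Cauchy (\<lambda>n. y n \<bullet> v)"
  proof (rule CauchyI)
    fix e :: real assume "e > 0"
    \<comment> \<open>Replacing \<open>v\<close> by \<open>d\<close> costs at most
      \<open>e / 4\<close> uniformly in \<open>n\<close>, so two replacements and one Cauchy
      estimate stay below \<open>e\<close>. The \<open>+ 1\<close> keeps the denominator positive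
      when \<open>R = 0\<close>.\<close>
    then have "0 < e / (4 * (R + 1))" using R0 by simp
    then obtain d where d: "d \<in> D" "d \<in> ball v (e / (4 * (R + 1)))"
      using D[of "ball v (e / (4 * (R + 1)))"] by (metis centre_in_ball empty_iff open_ball)
    have near: "\<bar>y n \<bullet> v - y n \<bullet> d\<bar> \<le> e / 4" for n
    proof -
      have "\<bar>y n \<bullet> (v - d)\<bar> \<le> norm (y n) * norm (v - d)" by (rule Cauchy_Schwarz_ineq2)
      also have "\<dots> \<le> (R + 1) * (e / (4 * (R + 1)))"
        using d R[of n] R0 by (intro mult_mono) (auto simp: dist_norm)
      also have "\<dots> = e / 4" using R0 by (simp add: field_simps)
      finally show ?thesis by (simp add: inner_simps)
    qed
    have "Cauchy (\<lambda>n. y n \<bullet> d)" using conv[OF d(1)] by (rule convergent_Cauchy)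
    then obtain K where K: "\<And>m n. m \<ge> K \<Longrightarrow> n \<ge> K \<Longrightarrow> norm (y m \<bullet> d - y n \<bullet> d) < e / 4"
      using \<open>e > 0\<close> by (metis CauchyD zero_less_divide_iff zero_less_numeral)
    have "norm (y m \<bullet> v - y n \<bullet> v) < e" if "m \<ge> K" "n \<ge> K" for m n
      using near[of m] near[of n] K[OF that] unfolding real_norm_def by linarith
    then show "\<exists>M. \<forall>m\<ge>M. \<forall>n\<ge>M. norm (y m \<bullet> v - y n \<bullet> v) < e" by blast
  qed
  then show ?thesis by (rule Cauchy_convergent)
qed

text \<open>
  Instead of representing the limit functional by Riesz, the weak limit is found as a common point of
  the closed convex hulls of the tails.
\<close>

lemma bounded_imp_weak_accumulation_point:
  fixes x :: "nat \<Rightarrow> 'a::{real_inner, complete_space, second_countable_topology}"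
  assumes "bounded (range x)"
  obtains u where "weak_accumulation_point x u"
proof -
  obtain R where R: "\<And>n. norm (x n) \<le> R" using assms by (auto simp: bounded_iff)
  then have R0: "R \<ge> 0" using norm_ge_zero order_trans by blast
  obtain D :: "'a set" where D: "countable D" "\<And>U. open U \<Longrightarrow> U \<noteq> {} \<Longrightarrow> \<exists>d\<in>D. d \<in> U"
    by (rule countable_dense_setE) blast
  \<comment> \<open>Dividing by \<open>norm d\<close> makes the bound uniform in \<open>d\<close>,
    as the diagonal argument below is applied with a single bound. For \<open>d = 0\<close> the
    quotient is 0 by convention.\<close>
  have "norm (x n \<bullet> d / norm d) \<le> R" for n d
  proof -
    have "\<bar>x n \<bullet> d\<bar> \<le> norm (x n) * norm d" by (rule Cauchy_Schwarz_ineq2)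
    also have "\<dots> \<le> R * norm d" by (intro mult_right_mono R) auto
    finally show ?thesis using R0 by (cases "d = 0") (auto simp: field_simps)
  qed
  then obtain k where k: "strict_mono k" "\<And>d. d \<in> D \<Longrightarrow> \<exists>l. (\<lambda>n. x (k n) \<bullet> d / norm d) \<longlonglongrightarrow> l"
    using function_convergent_subsequence[OF D(1), where f = "\<lambda>n d. x n \<bullet> d / norm d"] by blast
  define y where "y n = x (k n)" for n
  have "convergent (\<lambda>n. y n \<bullet> d)" if d: "d \<in> D" for d
  proof -
    obtain l where "(\<lambda>n. x (k n) \<bullet> d / norm d) \<longlonglongrightarrow> l" using k(2)[OF d] by blast
    then have "(\<lambda>n. x (k n) \<bullet> d / norm d * norm d) \<longlonglongrightarrow> l * norm d" by (intro tendsto_intros)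
    moreover have "x (k n) \<bullet> d / norm d * norm d = y n \<bullet> d" for n
      by (cases "d = 0") (auto simp: y_def)
    ultimately show ?thesis by (auto simp: convergent_def)
  qed
  then have conv: "convergent (\<lambda>n. y n \<bullet> v)" for v
    using convergent_inner_of_dense[of y R D] R D(2) by (auto simp: y_def)
  define C where "C n = closure (convex hull (y ` {n..}))" for n
  have yC: "y m \<in> C n" if "n \<le> m" for m n
    unfolding C_def using that by (intro closure_subset[THEN subsetD] hull_inc) auto
  have "decseq C" unfolding C_def decseq_def by (intro allI impI closure_mono hull_mono) auto
  then obtain u where u: "\<And>n. u \<in> C n"
    using nested_convex_least_norm_point[of C R] R yC
    by (metis C_def closed_closure convex_closure convex_convex_hull order_refl y_def)
  have "weakly_converges y u"
    unfolding weakly_converges_def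
  proof
    fix v
    obtain l where l: "(\<lambda>n. y n \<bullet> v) \<longlonglongrightarrow> l" using conv by (auto simp: convergent_def)
    have "\<bar>u \<bullet> v - l\<bar> \<le> e" if "e > 0" for e
    proof -
      obtain N where N: "\<And>n. n \<ge> N \<Longrightarrow> \<bar>y n \<bullet> v - l\<bar> < e"
        using LIMSEQ_D[OF l \<open>e > 0\<close>] by auto
      \<comment> \<open>A closed convex slab that contains the tail from \<open>N\<close> contains
        its closed convex hull \<open>C N\<close>, and hence \<open>u\<close>.\<close>
      define H where "H = (\<lambda>z. z \<bullet> v) -` cball l e"
      have "closed H" unfolding H_def by (intro closed_vimage closed_cball continuous_intros)
      moreover have "convex H"
        unfolding H_def by (intro convex_linear_vimage bounded_linear.linear bounded_linear_inner_left convex_cball)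
      moreover have "y ` {N..} \<subseteq> H" using N by (force simp: H_def dist_real_def abs_minus_commute)
      ultimately have "C N \<subseteq> H" unfolding C_def by (intro closure_minimal hull_minimal)
      then show ?thesis using u[of N] by (auto simp: H_def dist_real_def abs_minus_commute)
    qed
    then have "u \<bullet> v = l" by (metis abs_le_zero_iff eq_iff_diff_eq_0 field_le_epsilon add_0)
    then show "(\<lambda>n. y n \<bullet> v) \<longlonglongrightarrow> u \<bullet> v" using l by simp
  qed
  then have "weak_accumulation_point x u"
    using k(1) unfolding weak_accumulation_point_def y_def comp_def by blast
  then show thesis by (rule that)
qed

lemma weakly_converges_subseq:
  "weakly_converges x u \<Longrightarrow> strict_mono r \<Longrightarrow> weakly_converges (x \<circ> r) u"
  unfolding weakly_converges_def using LIMSEQ_subseq_LIMSEQ by (fastforce simp: comp_def)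

text \<open>Otherwise a subsequence of images stays away from \<open>B u\<close>, while compactness
  makes a further subsequence converge to some \<open>w\<close>. Preimages of closed balls around
  \<open>w\<close> are closed and convex, so they contain the weak limit \<open>u\<close>; this
  identifies \<open>w\<close> with \<open>B u\<close> without functionals on the target
  space.\<close>

lemma compact_operator_weak_to_strong:
  fixes B :: "'a::{real_inner, complete_space} \<Rightarrow> 'b::real_normed_vector"
  assumes B: "compact_operator B" and bd: "bounded (range x)" and x: "weakly_converges x u"
  shows "(\<lambda>n. B (x n)) \<longlonglongrightarrow> B u"
proof (rule ccontr)
  assume "\<not> ?thesis"
  then obtain e where e: "e > 0" and "\<not> (\<forall>\<^sub>F n in sequentially. dist (B (x n)) (B u) < e)"
    by (auto simp: tendsto_iff)
  then have "infinite {n. \<not> dist (B (x n)) (B u) < e}"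
    by (auto simp: eventually_cofinite[symmetric] cofinite_eq_sequentially)
  then obtain r :: "nat \<Rightarrow> nat" where r: "strict_mono r" and far: "\<And>n. \<not> dist (B (x (r n))) (B u) < e"
    using infinite_enumerate[of "{n. \<not> dist (B (x n)) (B u) < e}"] by blast
  have bl: "bounded_linear B" using B by (simp add: compact_operator_def)
  have "compact (closure (B ` range x))" using B bd by (simp add: compact_operator_def)
  moreover have "B (x (r n)) \<in> closure (B ` range x)" for n
    by (rule closure_subset[THEN subsetD]) auto
  ultimately obtain w s where s: "strict_mono (s :: nat \<Rightarrow> nat)" and w: "(\<lambda>n. B (x (r (s n)))) \<longlonglongrightarrow> w"
    using seq_compactE[of "closure (B ` range x)" "\<lambda>n. B (x (r n))"]
    unfolding compact_eq_seq_compact_metric comp_def by metis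
  have weak: "weakly_converges (x \<circ> (r \<circ> s)) u"
    by (rule weakly_converges_subseq[OF x strict_mono_o[OF r s]])
  have "dist w (B u) \<le> d" if "d > 0" for d
  proof -
    have "closed (B -` cball w d)"
      by (intro closed_vimage closed_cball) (use bl linear_continuous_on in blast)
    moreover have "convex (B -` cball w d)"
      by (intro convex_linear_vimage bounded_linear.linear[OF bl] convex_cball)
    moreover have "\<forall>\<^sub>F n in sequentially. (x \<circ> (r \<circ> s)) n \<in> B -` cball w d"
      using tendstoD[OF w that] by eventually_elim (auto simp: dist_commute)
    ultimately have "u \<in> B -` cball w d"
      by (intro weak_limit_in_closed_convex[OF _ _ eventually_frequently weak]) auto
    then show ?thesis by simp
  qed
  then have "dist w (B u) \<le> 0" by (rule field_le_epsilon) simp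
  then have "w = B u" by simp
  with tendstoD[OF w e] have "\<forall>\<^sub>F n in sequentially. dist (B (x (r (s n)))) (B u) < e" by simp
  then show False using far by (auto simp: eventually_sequentially)
qed

section \<open>Weak lower semicontinuity of closed convex functions\<close>

lemma closed_sublevel:
  fixes \<psi> :: "'a::topological_space \<Rightarrow> ereal"
  assumes "closed_fun \<psi>"
  shows "closed {u. \<psi> u \<le> ereal t}"
proof -
  have "closed ((\<lambda>u. (u, t)) -` epigraph \<psi>)"
    using assms unfolding closed_fun_def by (intro closed_vimage continuous_intros)
  then show ?thesis by (simp add: epigraph_def vimage_def)
qed

lemma convex_sublevel:
  fixes \<psi> :: "'a::real_vector \<Rightarrow> ereal"
  assumes "convex_fun \<psi>"
  shows "convex {u. \<psi> u \<le> ereal t}"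
proof (rule convexI)
  fix x y :: 'a and a b :: real
  assume *: "x \<in> {u. \<psi> u \<le> ereal t}" "y \<in> {u. \<psi> u \<le> ereal t}" "0 \<le> a" "0 \<le> b" "a + b = 1"
  then have "a *\<^sub>R (x, t) + b *\<^sub>R (y, t) \<in> epigraph \<psi>"
    using assms unfolding convex_fun_def by (intro convexD) (auto simp: epigraph_def)
  moreover have "a * t + b * t = t" using *(5) by (metis distrib_right mult_1)
  ultimately show "a *\<^sub>R x + b *\<^sub>R y \<in> {u. \<psi> u \<le> ereal t}" by (simp add: epigraph_def)
qed

text \<open>If the inequality failed, a sublevel set at a height strictly between the two sides
  would contain \<open>x n\<close> infinitely often, hence also the weak limit.\<close>

lemma weakly_lsc:
  fixes \<psi> :: "'a::{real_inner, complete_space} \<Rightarrow> ereal"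
  assumes "closed_fun \<psi>" "convex_fun \<psi>" "weakly_converges x u"
  shows "\<psi> u \<le> liminf (\<lambda>n. \<psi> (x n))"
proof (rule ccontr)
  assume "\<not> ?thesis"
  then obtain t where t: "liminf (\<lambda>n. \<psi> (x n)) < ereal t" "ereal t < \<psi> u"
    by (metis ereal_dense2 not_le)
  have "\<exists>\<^sub>F n in sequentially. x n \<in> {u. \<psi> u \<le> ereal t}"
  proof (rule ccontr)
    assume "\<not> ?thesis"
    then have "\<forall>\<^sub>F n in sequentially. ereal t \<le> \<psi> (x n)"
      by (auto simp: not_frequently elim!: eventually_mono)
    then have "ereal t \<le> liminf (\<lambda>n. \<psi> (x n))" by (rule Liminf_bounded)
    then show False using t by simp
  qed
  then have "u \<in> {u. \<psi> u \<le> ereal t}"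
    by (intro weak_limit_in_closed_convex[OF closed_sublevel convex_sublevel _ assms(3)] assms)
  then show False using t by simp
qed

section \<open>The strong law of large numbers\<close>

text \<open>The maximum of 0 and the first \<open>n\<close> partial sums. The recursion peels off
  the first term rather than the last, so that the relation to the shifted sequence used in the
  maximal inequality holds by unfolding.\<close>

primrec sup_partial_sums :: "nat \<Rightarrow> (nat \<Rightarrow> real) \<Rightarrow> real" where
  "sup_partial_sums 0 x = 0"
| "sup_partial_sums (Suc n) x = max 0 (x 0 + sup_partial_sums n (\<lambda>i. x (Suc i)))"

lemma sup_partial_sums_nonneg: "0 \<le> sup_partial_sums n x"
  by (cases n) auto

lemma sup_partial_sums_mono: "sup_partial_sums n x \<le> sup_partial_sums (Suc n) x"
proof (induction n arbitrary: x)
  case (Suc n)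
  show ?case using Suc.IH[of "\<lambda>i. x (Suc i)"] by (simp only: sup_partial_sums.simps)
qed simp

lemma sum_le_sup_partial_sums: "sum x {..<n} \<le> sup_partial_sums n x"
proof (induction n arbitrary: x)
  case (Suc n)
  show ?case using Suc.IH[of "\<lambda>i. x (Suc i)"] unfolding sum.lessThan_Suc_shift by (simp add: comp_def)
qed simp

lemma sup_partial_sums_le_sum_abs: "sup_partial_sums n x \<le> (\<Sum>i<n. \<bar>x i\<bar>)"
proof (induction n arbitrary: x)
  case (Suc n)
  show ?case using Suc.IH[of "\<lambda>i. x (Suc i)"] sum_nonneg[of "{..<n}" "\<lambda>i. \<bar>x (Suc i)\<bar>"]
    unfolding sum.lessThan_Suc_shift by (simp add: comp_def)
qed simp

lemma measurable_shift:
  "(\<lambda>x i. x (Suc i)) \<in> (\<Pi>\<^sub>M i\<in>(UNIV::nat set). (borel :: real measure)) \<rightarrow>\<^sub>M (\<Pi>\<^sub>M i\<in>UNIV. borel)"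
  by (rule measurable_PiM_single') (simp_all add: measurable_component_singleton space_PiM)

lemma measurable_sup_partial_sums [measurable]:
  "sup_partial_sums n \<in> borel_measurable (\<Pi>\<^sub>M i\<in>UNIV. borel)"
proof (induction n)
  case 0
  have "sup_partial_sums 0 = (\<lambda>_. 0)" by auto
  then show ?case by simp
next
  case (Suc n)
  have "(\<lambda>x. sup_partial_sums n (\<lambda>i. x (Suc i))) \<in> borel_measurable (\<Pi>\<^sub>M i\<in>UNIV. borel)"
    by (rule measurable_compose[OF measurable_shift Suc])
  moreover have "sup_partial_sums (Suc n) = (\<lambda>x. max 0 (x 0 + sup_partial_sums n (\<lambda>i. x (Suc i))))" by auto
  ultimately show ?case
    by (simp only:) (intro borel_measurable_max borel_measurable_const borel_measurable_add
        measurable_component_singleton UNIV_I)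
qed

text \<open>Dropping the first term changes the later partial sums by the fixed amount
  \<open>x 0\<close>, which does not affect unboundedness. Thresholds are natural numbers so that
  the event is a countable combination of measurable sets.\<close>

lemma sup_partial_sums_unbounded_shift:
  "(\<forall>c::nat. \<exists>n. c < sup_partial_sums n x) \<longleftrightarrow> (\<forall>c::nat. \<exists>n. c < sup_partial_sums n (\<lambda>i. x (Suc i)))"
    (is "?P x \<longleftrightarrow> ?P ?y")
proof safe
  fix c :: nat assume *: "?P x"
  obtain k :: nat where k: "real c + \<bar>x 0\<bar> < k" using reals_Archimedean2 by blast
  then obtain n where n: "k < sup_partial_sums n x" using * by blast
  then obtain m where "n = Suc m" by (cases n) auto
  with n k show "\<exists>n. c < sup_partial_sums n ?y" by (intro exI[of _ m]) auto
next
  fix c :: nat assume *: "?P ?y"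
  obtain k :: nat where k: "real c + \<bar>x 0\<bar> < k" using reals_Archimedean2 by blast
  then obtain n where "k < sup_partial_sums n ?y" using * by blast
  with k show "\<exists>n. c < sup_partial_sums n x" by (intro exI[of _ "Suc n"]) auto
qed

section \<open>Independent sequences and the almost sure behaviour of their averages\<close>

context prob_space
begin

lemma indep_vars_inj_reindex:
  assumes "inj_on f I" and "indep_vars (\<lambda>_. N) X (f ` I)"
  shows "indep_vars (\<lambda>_. N) (\<lambda>i. X (f i)) I"
  unfolding indep_vars_def2
proof (intro conjI ballI indep_setsI)
  let ?F = "\<lambda>k. {X k -` A \<inter> space M |A. A \<in> sets N}"
  have X: "X k \<in> M \<rightarrow>\<^sub>M N" if "k \<in> f ` I" for k
    using assms(2) that by (auto simp: indep_vars_def2)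
  show "X (f i) \<in> M \<rightarrow>\<^sub>M N" if "i \<in> I" for i using X that by blast
  show "?F (f i) \<subseteq> events" if "i \<in> I" for i
    using X[of "f i"] that by (auto intro: measurable_sets)
  fix A J assume J: "J \<noteq> {}" "J \<subseteq> I" "finite J" and A: "\<forall>j\<in>J. A j \<in> ?F (f j)"
  have inj: "inj_on f J" using assms(1) J(2) by (rule inj_on_subset)
  define A' where "A' k = A (the_inv_into J f k)" for k
  have A': "A' (f j) = A j" if "j \<in> J" for j
    using that inj by (simp add: A'_def the_inv_into_f_f)
  have indep: "indep_sets ?F (f ` I)" using assms(2) by (simp add: indep_vars_def2)
  have "\<forall>k\<in>f ` J. A' k \<in> ?F k"
  proof
    fix k assume "k \<in> f ` J"
    then obtain j where "j \<in> J" "k = f j" by blast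
    then show "A' k \<in> ?F k" using bspec[OF A \<open>j \<in> J\<close>] A' by simp
  qed
  then have "prob (\<Inter>k\<in>f ` J. A' k) = (\<Prod>k\<in>f ` J. prob (A' k))"
    using J by (intro indep_setsD[OF indep]) auto
  moreover have "(\<Inter>k\<in>f ` J. A' k) = (\<Inter>j\<in>J. A j)" using A' by blast
  moreover have "(\<Prod>k\<in>f ` J. prob (A' k)) = (\<Prod>j\<in>J. prob (A j))"
    by (simp add: prod.reindex[OF inj] A')
  ultimately show "prob (\<Inter>j\<in>J. A j) = (\<Prod>j\<in>J. prob (A j))" by simp
qed

text \<open>
  A maximal-inequality argument. Let \<open>A\<close> be the shift-invariant event that the partial sums are unbounded
  above and \<open>M\<^sub>n\<close> the maximum of \<open>0\<close> and the first \<open>n\<close> partial sums. Writing \<open>M'\<^sub>n\<close> for the same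
  quantity of the shifted sequence, \<open>M\<^bsub>n+1\<^esub> - M'\<^sub>n = max (-M'\<^sub>n) X\<^sub>0\<close> has nonnegative integral over \<open>A\<close>
  by stationarity and tends to \<open>X\<^sub>0\<close> there; as \<open>X\<^sub>0\<close> is independent of \<open>A\<close>, \<open>0 \<le> P(A) E X\<^sub>0\<close>.
\<close>

lemma AE_partial_sums_bounded_above:
  fixes X :: "nat \<Rightarrow> 'a \<Rightarrow> real"
  assumes indep: "indep_vars (\<lambda>_. borel) X UNIV"
    and ident: "\<And>i. distr M borel (X i) = distr M borel (X 0)"
    and int0: "integrable M (X 0)" and neg: "expectation (X 0) < 0"
  shows "AE \<omega> in M. \<exists>c. \<forall>n. (\<Sum>i<n. X i \<omega>) \<le> c"
proof -
  let ?S = "\<Pi>\<^sub>M i\<in>(UNIV::nat set). (borel :: real measure)"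
  have X[measurable]: "X i \<in> borel_measurable M" for i
    using indep unfolding indep_vars_def by simp
  have int: "integrable M (X i)" for i
    using int0 integrable_distr_eq[OF X[of i], of "\<lambda>x. x"] integrable_distr_eq[OF X[of 0], of "\<lambda>x. x"]
    by (simp add: ident[of i])
  define Y where "Y \<omega> = (\<lambda>i. X i \<omega>)" for \<omega>
  define Y' where "Y' \<omega> = (\<lambda>i. X (Suc i) \<omega>)" for \<omega>
  have Y[measurable]: "Y \<in> M \<rightarrow>\<^sub>M ?S" unfolding Y_def by (intro measurable_PiM_single') auto
  have Y'[measurable]: "Y' \<in> M \<rightarrow>\<^sub>M ?S" unfolding Y'_def by (intro measurable_PiM_single') auto
  \<comment> \<open>Stationarity: independence makes the laws of the sequence and of its shift
    product measures, and their marginals agree.\<close>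
  have "distr M ?S Y = (\<Pi>\<^sub>M i\<in>UNIV. distr M borel (X i))"
    using indep_vars_iff_distr_eq_PiM[of UNIV X "\<lambda>_. borel"] indep by (simp add: Y_def[abs_def] restrict_def)
  moreover have "indep_vars (\<lambda>_. borel) (\<lambda>i. X (Suc i)) UNIV"
    by (rule indep_vars_inj_reindex) (use indep_vars_subset[OF indep] in auto)
  then have "distr M ?S Y' = (\<Pi>\<^sub>M i\<in>UNIV. distr M borel (X (Suc i)))"
    using indep_vars_iff_distr_eq_PiM[of UNIV "\<lambda>i. X (Suc i)" "\<lambda>_. borel"] by (simp add: Y'_def[abs_def] restrict_def)
  moreover have "(\<lambda>i. distr M borel (X (Suc i))) = (\<lambda>i. distr M borel (X i))"
    by (rule ext) (metis ident)
  ultimately have shift: "distr M ?S Y' = distr M ?S Y" by simp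

  define U where "U = {x \<in> space ?S. \<forall>c::nat. \<exists>n. c < sup_partial_sums n x}"
  have U[measurable]: "U \<in> sets ?S" unfolding U_def by measurable
  have UY: "Y \<omega> \<in> U \<longleftrightarrow> Y' \<omega> \<in> U" for \<omega>
    using sup_partial_sums_unbounded_shift[of "Y \<omega>"] by (simp add: U_def Y_def Y'_def space_PiM)
  \<comment> \<open>By \<open>UY\<close> the indicator could be read off \<open>Y\<close> as well.
    Reading it off \<open>Y'\<close> shows that it depends only on the variables from index 1 on,
    which yields independence from \<open>X 0\<close>.\<close>
  define I where "I \<omega> = indicat_real U (Y' \<omega>)" for \<omega>
  have I[measurable]: "I \<in> borel_measurable M" unfolding I_def by measurable
  have I01: "0 \<le> I \<omega>" "I \<omega> \<le> 1" for \<omega> by (auto simp: I_def indicator_def)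

  have int_sup: "integrable M (\<lambda>\<omega>. sup_partial_sums n (Y \<omega>))" for n
  proof (rule Bochner_Integration.integrable_bound[of _ "\<lambda>\<omega>. \<Sum>i<n. \<bar>X i \<omega>\<bar>"])
    show "integrable M (\<lambda>\<omega>. \<Sum>i<n. \<bar>X i \<omega>\<bar>)" using int by auto
    show "AE \<omega> in M. norm (sup_partial_sums n (Y \<omega>)) \<le> norm (\<Sum>i<n. \<bar>X i \<omega>\<bar>)"
      using sup_partial_sums_le_sum_abs[of n] by (auto simp: sup_partial_sums_nonneg Y_def)
  qed measurable
  have int_sup': "integrable M (\<lambda>\<omega>. sup_partial_sums n (Y' \<omega>))" for n
    using int_sup[of n] integrable_distr_eq[OF Y, of "sup_partial_sums n"]
      integrable_distr_eq[OF Y', of "sup_partial_sums n"] shift by simp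
  have int_I: "integrable M (\<lambda>\<omega>. I \<omega> * g \<omega>)" if "integrable M g" for g :: "'a \<Rightarrow> real"
    using that by (rule Bochner_Integration.integrable_bound)
      (use that I01 in \<open>auto simp: abs_mult intro!: mult_left_le_one_le\<close>)
  have stat: "(\<integral>\<omega>. I \<omega> * sup_partial_sums n (Y' \<omega>) \<partial>M) = (\<integral>\<omega>. I \<omega> * sup_partial_sums n (Y \<omega>) \<partial>M)" for n
  proof -
    have "(\<integral>\<omega>. I \<omega> * sup_partial_sums n (Y' \<omega>) \<partial>M) = (\<integral>x. indicator U x * sup_partial_sums n x \<partial>distr M ?S Y')"
      unfolding I_def by (subst integral_distr) auto
    also have "\<dots> = (\<integral>\<omega>. indicator U (Y \<omega>) * sup_partial_sums n (Y \<omega>) \<partial>M)"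
      unfolding shift by (subst integral_distr) auto
    also have "\<dots> = (\<integral>\<omega>. I \<omega> * sup_partial_sums n (Y \<omega>) \<partial>M)"
      by (simp add: I_def indicator_def UY)
    finally show ?thesis .
  qed
  have step: "0 \<le> (\<integral>\<omega>. I \<omega> * max (- sup_partial_sums n (Y' \<omega>)) (X 0 \<omega>) \<partial>M)" for n
  proof -
    have "max (- sup_partial_sums n (Y' \<omega>)) (X 0 \<omega>) = sup_partial_sums (Suc n) (Y \<omega>) - sup_partial_sums n (Y' \<omega>)" for \<omega>
      by (simp add: Y_def Y'_def)
    then have "(\<integral>\<omega>. I \<omega> * max (- sup_partial_sums n (Y' \<omega>)) (X 0 \<omega>) \<partial>M) =
      (\<integral>\<omega>. I \<omega> * sup_partial_sums (Suc n) (Y \<omega>) - I \<omega> * sup_partial_sums n (Y' \<omega>) \<partial>M)"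
      by (simp add: right_diff_distrib)
    also have "\<dots> = (\<integral>\<omega>. I \<omega> * sup_partial_sums (Suc n) (Y \<omega>) \<partial>M) - (\<integral>\<omega>. I \<omega> * sup_partial_sums n (Y \<omega>) \<partial>M)"
      using stat by (subst Bochner_Integration.integral_diff) (auto intro!: int_I int_sup int_sup' simp del: sup_partial_sums.simps)
    also have "\<dots> \<ge> 0"
      using I01 by (auto intro!: integral_mono int_I int_sup mult_left_mono sup_partial_sums_mono
          simp del: sup_partial_sums.simps)
    finally show ?thesis .
  qed
  have "(\<lambda>n. \<integral>\<omega>. I \<omega> * max (- sup_partial_sums n (Y' \<omega>)) (X 0 \<omega>) \<partial>M) \<longlonglongrightarrow> (\<integral>\<omega>. I \<omega> * X 0 \<omega> \<partial>M)"
  proof (rule integral_dominated_convergence[where w = "\<lambda>\<omega>. \<bar>X 0 \<omega>\<bar>"])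
    show "AE \<omega> in M. (\<lambda>n. I \<omega> * max (- sup_partial_sums n (Y' \<omega>)) (X 0 \<omega>)) \<longlonglongrightarrow> I \<omega> * X 0 \<omega>"
    proof (intro AE_I2)
      fix \<omega>
      show "(\<lambda>n. I \<omega> * max (- sup_partial_sums n (Y' \<omega>)) (X 0 \<omega>)) \<longlonglongrightarrow> I \<omega> * X 0 \<omega>"
      proof (cases "Y' \<omega> \<in> U")
        case True
        \<comment> \<open>Once the maximum for the shifted sequence exceeds the absolute value of
          \<open>X 0\<close>, the truncated variable equals \<open>X 0\<close> exactly, so the
          sequence is eventually constant.\<close>
        obtain k :: nat where k: "\<bar>X 0 \<omega>\<bar> < k" using reals_Archimedean2 by blast
        obtain N where N: "k < sup_partial_sums N (Y' \<omega>)" using True by (auto simp: U_def)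
        have "incseq (\<lambda>n. sup_partial_sums n (Y' \<omega>))"
          using sup_partial_sums_mono by (rule incseq_SucI)
        then have "\<bar>X 0 \<omega>\<bar> \<le> sup_partial_sums n (Y' \<omega>)" if "N \<le> n" for n
          using incseqD[OF _ that] N k by fastforce
        then have "\<forall>\<^sub>F n in sequentially. I \<omega> * max (- sup_partial_sums n (Y' \<omega>)) (X 0 \<omega>) = I \<omega> * X 0 \<omega>"
          by (intro eventually_sequentiallyI[of N]) (smt (verit) max_def)
        then show ?thesis by (rule tendsto_eventually)
      qed (simp add: I_def)
    qed
    show "AE \<omega> in M. norm (I \<omega> * max (- sup_partial_sums n (Y' \<omega>)) (X 0 \<omega>)) \<le> \<bar>X 0 \<omega>\<bar>" for n
    proof (intro AE_I2)
      fix \<omega>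
      have "\<bar>max (- sup_partial_sums n (Y' \<omega>)) (X 0 \<omega>)\<bar> \<le> \<bar>X 0 \<omega>\<bar>"
        using sup_partial_sums_nonneg[of n "Y' \<omega>"] by linarith
      then show "norm (I \<omega> * max (- sup_partial_sums n (Y' \<omega>)) (X 0 \<omega>)) \<le> \<bar>X 0 \<omega>\<bar>"
        using I01[of \<omega>] by (simp add: abs_mult) (meson abs_ge_zero mult_left_le_one_le order_trans)
    qed
  qed (use int0 in auto)
  then have "0 \<le> (\<integral>\<omega>. I \<omega> * X 0 \<omega> \<partial>M)"
    by (rule LIMSEQ_le_const) (use step in auto)
  moreover have "(\<integral>\<omega>. I \<omega> * X 0 \<omega> \<partial>M) = expectation I * expectation (X 0)"
  proof (rule indep_var_lebesgue_integral)
    have "(\<lambda>y. \<lambda>i. y (Suc i)) \<in> (\<Pi>\<^sub>M i\<in>{1..}. (borel :: real measure)) \<rightarrow>\<^sub>M ?S"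
      by (intro measurable_PiM_single') (auto intro!: measurable_component_singleton)
    then have *: "(\<lambda>y. indicat_real U (\<lambda>i. y (Suc i))) \<in> borel_measurable (\<Pi>\<^sub>M i\<in>{1..}. borel)"
      by (rule measurable_compose) (rule borel_measurable_indicator[OF U])
    \<comment> \<open>Disjoint blocks of indices are independent; \<open>I\<close> is a function of
      the first block and \<open>X 0\<close> of the second.\<close>
    have "indep_var (\<Pi>\<^sub>M i\<in>{1..}. borel) (\<lambda>\<omega>. restrict (\<lambda>i. X i \<omega>) {1..}) (\<Pi>\<^sub>M i\<in>{0}. borel) (\<lambda>\<omega>. restrict (\<lambda>i. X i \<omega>) {0})"
      by (rule indep_var_restrict[OF indep]) auto
    from indep_var_compose[OF this *, of "\<lambda>y. y 0" borel] show "indep_var borel I borel (X 0)"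
      by (simp add: comp_def I_def[abs_def] Y'_def)
    show "integrable M I" using int_I[of "\<lambda>_. 1"] by simp
  qed fact
  ultimately have "expectation I \<le> 0" using neg by (simp add: zero_le_mult_iff not_le)
  then have "expectation I = 0" using I01 by (intro antisym integral_nonneg) auto
  then have "AE \<omega> in M. I \<omega> = 0"
    using I01 int_I[of "\<lambda>_. 1"] by (subst (asm) integral_nonneg_eq_0_iff_AE) auto
  then show ?thesis
  proof (rule AE_mp, intro AE_I2 impI)
    fix \<omega> assume "I \<omega> = 0"
    then have "Y \<omega> \<notin> U" by (simp add: I_def UY indicator_def split: if_splits)
    then obtain c :: nat where c: "\<And>n. sup_partial_sums n (Y \<omega>) \<le> c"
      by (auto simp: U_def space_PiM not_less)
    have "(\<Sum>i<n. X i \<omega>) \<le> c" for n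
      using order_trans[OF sum_le_sup_partial_sums c[of n]] by (simp add: Y_def)
    then show "\<exists>c. \<forall>n. (\<Sum>i<n. X i \<omega>) \<le> c" by blast
  qed
qed

text \<open>After subtracting \<open>?\<mu> + e\<close> the variables have negative mean, so their
  partial sums stay below some \<open>c\<close> and the averages stay below
  \<open>?\<mu> + e + c / n\<close>.\<close>

lemma AE_averages_eventually_less:
  fixes X :: "nat \<Rightarrow> 'a \<Rightarrow> real"
  assumes indep: "indep_vars (\<lambda>_. borel) X UNIV"
    and ident: "\<And>i. distr M borel (X i) = distr M borel (X 0)"
    and int0: "integrable M (X 0)"
  shows "AE \<omega> in M. \<forall>a > expectation (X 0). \<forall>\<^sub>F n in sequentially. (\<Sum>i<n. X i \<omega>) / n < a"
proof -
  let ?\<mu> = "expectation (X 0)"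
  have X[measurable]: "X i \<in> borel_measurable M" for i
    using indep unfolding indep_vars_def by simp
  have "AE \<omega> in M. \<exists>c. \<forall>n. (\<Sum>i<n. X i \<omega> - (?\<mu> + e)) \<le> c" if e: "e > 0" for e
  proof (rule AE_partial_sums_bounded_above)
    show "indep_vars (\<lambda>_. borel) (\<lambda>i \<omega>. X i \<omega> - (?\<mu> + e)) UNIV"
      by (rule indep_vars_compose2[OF indep]) measurable
    show "distr M borel (\<lambda>\<omega>. X i \<omega> - (?\<mu> + e)) = distr M borel (\<lambda>\<omega>. X 0 \<omega> - (?\<mu> + e))" for i
    proof -
      have "distr (distr M borel (X j)) borel (\<lambda>x. x - (?\<mu> + e)) = distr M borel (\<lambda>\<omega>. X j \<omega> - (?\<mu> + e))" for j
        by (subst distr_distr) (auto simp: comp_def)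
      then show ?thesis by (metis ident)
    qed
    show "integrable M (\<lambda>\<omega>. X 0 \<omega> - (?\<mu> + e))" using int0 by auto
    show "expectation (\<lambda>\<omega>. X 0 \<omega> - (?\<mu> + e)) < 0" using int0 e by (simp add: prob_space)
  qed
  \<comment> \<open>Restricting \<open>e\<close> to the values \<open>1 / Suc k\<close> leaves
    countably many null sets, whose union serves every \<open>a\<close> at once.\<close>
  then have "AE \<omega> in M. \<forall>k::nat. \<exists>c. \<forall>n. (\<Sum>i<n. X i \<omega> - (?\<mu> + 1 / Suc k)) \<le> c"
    by (subst AE_all_countable) auto
  then show ?thesis
  proof (rule AE_mp, intro AE_I2 impI allI)
    fix \<omega> a assume *: "\<forall>k::nat. \<exists>c. \<forall>n. (\<Sum>i<n. X i \<omega> - (?\<mu> + 1 / Suc k)) \<le> c" and "?\<mu> < a"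
    then obtain k :: nat where k: "1 / Suc k < a - ?\<mu>"
      using reals_Archimedean[of "a - ?\<mu>"] by (auto simp: inverse_eq_divide)
    obtain c where c: "\<And>n. (\<Sum>i<n. X i \<omega> - (?\<mu> + 1 / Suc k)) \<le> c" using * by blast
    have "(\<lambda>n. (?\<mu> + 1 / Suc k) + c / real n) \<longlonglongrightarrow> (?\<mu> + 1 / Suc k) + 0"
      by (intro tendsto_add tendsto_const lim_const_over_n)
    then have "\<forall>\<^sub>F n in sequentially. (?\<mu> + 1 / Suc k) + c / real n < a"
      using k by (intro order_tendstoD) auto
    then show "\<forall>\<^sub>F n in sequentially. (\<Sum>i<n. X i \<omega>) / n < a"
      using eventually_gt_at_top[of 0]
    proof eventually_elim
      case (elim n)
      have "(\<Sum>i<n. X i \<omega>) \<le> real n * (?\<mu> + 1 / Suc k) + c" using c[of n] by (simp add: sum_subtractf)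
      then have "(\<Sum>i<n. X i \<omega>) / n \<le> (real n * (?\<mu> + 1 / Suc k) + c) / n" by (intro divide_right_mono) auto
      also have "\<dots> = (?\<mu> + 1 / Suc k) + c / real n" using elim(2) by (simp add: add_divide_distrib)
      finally show ?case using elim(1) by simp
    qed
  qed
qed

text \<open>The one-sided bound applied to \<open>X\<close> gives the upper half, and applied to the
  negated variables the lower half.\<close>

theorem strong_law_of_large_numbers:
  fixes X :: "nat \<Rightarrow> 'a \<Rightarrow> real"
  assumes indep: "indep_vars (\<lambda>_. borel) X UNIV"
    and ident: "\<And>i. distr M borel (X i) = distr M borel (X 0)"
    and int0: "integrable M (X 0)"
  shows "AE \<omega> in M. (\<lambda>n. (\<Sum>i<n. X i \<omega>) / n) \<longlonglongrightarrow> expectation (X 0)"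
proof -
  have X[measurable]: "X i \<in> borel_measurable M" for i
    using indep unfolding indep_vars_def by simp
  have "AE \<omega> in M. \<forall>a > expectation (\<lambda>\<omega>. - X 0 \<omega>). \<forall>\<^sub>F n in sequentially. (\<Sum>i<n. - X i \<omega>) / n < a"
  proof (rule AE_averages_eventually_less)
    show "indep_vars (\<lambda>_. borel) (\<lambda>i \<omega>. - X i \<omega>) UNIV"
      by (rule indep_vars_compose2[OF indep]) measurable
    show "distr M borel (\<lambda>\<omega>. - X i \<omega>) = distr M borel (\<lambda>\<omega>. - X 0 \<omega>)" for i
    proof -
      have "distr (distr M borel (X j)) borel uminus = distr M borel (\<lambda>\<omega>. - X j \<omega>)" for j
        by (subst distr_distr) (auto simp: comp_def)
      then show ?thesis by (metis ident)
    qed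
  qed (use int0 in auto)
  with AE_averages_eventually_less[OF assms] show ?thesis
  proof eventually_elim
    case (elim \<omega>)
    show ?case
    proof (rule order_tendstoI)
      fix a assume "a < expectation (X 0)"
      then have "\<forall>\<^sub>F n in sequentially. (\<Sum>i<n. - X i \<omega>) / n < - a" using elim(2) by simp
      then show "\<forall>\<^sub>F n in sequentially. a < (\<Sum>i<n. X i \<omega>) / n"
        by eventually_elim (simp add: sum_negf)
    qed (use elim(1) in blast)
  qed
qed

end

section \<open>Sample average approximation\<close>

text \<open>By continuity the infimum over \<open>S\<close> equals the infimum over a countable
  dense subset, which is measurable.\<close>

lemma borel_measurable_INF_continuous:
  fixes f :: "'w::{metric_space, second_countable_topology} \<Rightarrow> 'x \<Rightarrow> real"
  assumes cont: "\<And>x. continuous_on S (\<lambda>w. f w x)"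
    and meas: "\<And>w. w \<in> S \<Longrightarrow> f w \<in> borel_measurable N"
    and bdd: "\<And>x. bdd_below ((\<lambda>w. f w x) ` S)"
  shows "(\<lambda>x. INF w\<in>S. f w x) \<in> borel_measurable N"
proof (cases "S = {}")
  case False
  obtain T where T: "countable T" "T \<subseteq> S" "S \<subseteq> closure T" by (rule separable)
  have "T \<noteq> {}" using T(3) False by auto
  have "(INF w\<in>S. f w x) = (INF w\<in>T. f w x)" for x
  proof (rule antisym)
    show "(INF w\<in>S. f w x) \<le> (INF w\<in>T. f w x)"
      using T(2) \<open>T \<noteq> {}\<close> bdd by (intro cINF_superset_mono) auto
    show "(INF w\<in>T. f w x) \<le> (INF w\<in>S. f w x)"
    proof (rule cINF_greatest[OF False])
      fix w assume w: "w \<in> S"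
      then obtain d where d: "\<And>n. d n \<in> T" "d \<longlonglongrightarrow> w"
        using T(3) by (meson closure_sequential subsetD)
      have lim: "(\<lambda>n. f (d n) x) \<longlonglongrightarrow> f w x"
        using continuous_on_tendsto_compose[OF cont d(2) w] d(1) T(2) by (simp add: subset_iff)
      have "(INF w\<in>T. f w x) \<le> f (d n) x" for n
        by (rule cINF_lower[OF bdd_below_mono[OF bdd image_mono[OF T(2)]] d(1)])
      then show "(INF w\<in>T. f w x) \<le> f w x" using LIMSEQ_le_const[OF lim] by blast
    qed
  qed
  moreover have "(\<lambda>x. INF w\<in>T. f w x) \<in> borel_measurable N"
    using T meas by (intro borel_measurable_cINF_real) blast+
  ultimately show ?thesis by simp
qed simp

text \<open>The sample path is an argument, so that the consistency argument can run
  deterministically on one path. Samples are numbered from 1, and the average at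
  \<open>N = 0\<close> is 0.\<close>

definition sample_average :: "(nat \<Rightarrow> 'x) \<Rightarrow> nat \<Rightarrow> ('x \<Rightarrow> real) \<Rightarrow> real" where
  "sample_average s N g = (1 / real N) * (\<Sum>i=1..N. g (s i))"

lemma sample_average_mono:
  "(\<And>x. g x \<le> h x) \<Longrightarrow> sample_average s N g \<le> sample_average s N h"
  unfolding sample_average_def by (intro mult_left_mono sum_mono) auto

lemma sample_average_abs_le:
  assumes "\<And>x. \<bar>g x\<bar> \<le> h x"
  shows "\<bar>sample_average s N g\<bar> \<le> sample_average s N h"
proof -
  have *: "- h x \<le> g x" "g x \<le> h x" for x using assms[of x] by auto
  have "sample_average s N (\<lambda>x. - h x) \<le> sample_average s N g" using *(1) by (rule sample_average_mono)
  moreover have "sample_average s N g \<le> sample_average s N h" using *(2) by (rule sample_average_mono)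
  moreover have "sample_average s N (\<lambda>x. - h x) = - sample_average s N h"
    by (simp add: sample_average_def sum_negf)
  ultimately show ?thesis by linarith
qed

text \<open>
  The lower half of a uniform law of large numbers. It only uses the law for the countably many
  functions \<open>INF w \<in> V \<inter> E. f w\<close>, where \<open>V\<close> ranges over a countable base, and needs no compactness.
\<close>

lemma liminf_sample_average_ge:
  fixes f :: "'w::{metric_space, second_countable_topology} \<Rightarrow> 'x \<Rightarrow> real"
  assumes cont: "\<And>x. continuous_on E (\<lambda>w. f w x)"
    and meas: "\<And>w. w \<in> E \<Longrightarrow> f w \<in> borel_measurable P"
    and bound: "\<And>w x. w \<in> E \<Longrightarrow> \<bar>f w x\<bar> \<le> \<zeta> x" and \<zeta>: "integrable P \<zeta>"
    and base: "topological_basis \<V>"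
    and lln: "\<And>V. V \<in> \<V> \<Longrightarrow> V \<inter> E \<noteq> {} \<Longrightarrow>
      (\<lambda>N. sample_average s N (\<lambda>x. INF w\<in>V \<inter> E. f w x)) \<longlonglongrightarrow> (\<integral>x. (INF w\<in>V \<inter> E. f w x) \<partial>P)"
    and r: "strict_mono r"
    and y: "\<forall>\<^sub>F k in sequentially. y k \<in> E" "y \<longlonglongrightarrow> w" "w \<in> E"
  shows "ereal (\<integral>x. f w x \<partial>P) \<le> liminf (\<lambda>k. ereal (sample_average s (r k) (f (y k))))"
proof -
  have "\<exists>V. V \<in> \<V> \<and> w \<in> V \<and> V \<subseteq> ball w (1 / Suc j)" for j :: nat
    using topological_basisE[OF base, of "ball w (1 / Suc j)" w] by auto
  then obtain V where V: "\<And>j. V j \<in> \<V>" "\<And>j. w \<in> V j" "\<And>j. V j \<subseteq> ball w (1 / Suc j)" by metis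
  \<comment> \<open>These functions bound \<open>f v\<close> from below for all \<open>v\<close>
    near \<open>w\<close>, and by continuity they tend pointwise to \<open>f w\<close> as the
    neighbourhoods shrink.\<close>
  define h where "h j x = (INF v\<in>V j \<inter> E. f v x)" for j x
  have f_ge: "- \<zeta> x \<le> f v x" if "v \<in> E" for v x
    using bound[OF that, of x] by linarith
  have bddE: "bdd_below ((\<lambda>v. f v x) ` (V j \<inter> E))" for j x
    using f_ge by (intro bdd_belowI[of _ "- \<zeta> x"]) auto
  have h_le: "h j x \<le> f v x" if "v \<in> V j" "v \<in> E" for j x v
    unfolding h_def using that by (intro cINF_lower bddE) auto
  have h_ge: "- \<zeta> x \<le> h j x" for j x
    unfolding h_def using V(2) y(3) f_ge by (intro cINF_greatest) auto
  have h_lim: "(\<lambda>j. h j x) \<longlonglongrightarrow> f w x" for x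
  proof (rule LIMSEQ_I)
    fix e :: real assume e: "e > 0"
    then obtain d where d: "d > 0" "\<And>v. v \<in> E \<Longrightarrow> dist v w < d \<Longrightarrow> dist (f v x) (f w x) < e/2"
      using cont[of x] y(3) unfolding continuous_on_iff by (meson half_gt_zero)
    obtain J :: nat where J: "1 / Suc J < d" using reals_Archimedean[OF d(1)] by (auto simp: inverse_eq_divide)
    have "norm (h j x - f w x) < e" if "j \<ge> J" for j
    proof -
      have "1 / real (Suc j) \<le> 1 / real (Suc J)" using that by (simp add: frac_le)
      then have near: "dist v w < d" if "v \<in> V j" for v
        using J subsetD[OF V(3) that] by (simp add: dist_commute)
      have "f w x - e/2 \<le> f v x" if "v \<in> V j \<inter> E" for v
      proof -
        have "dist (f v x) (f w x) < e/2" using d(2) near that by blast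
        then show ?thesis unfolding dist_real_def by linarith
      qed
      then have "f w x - e/2 \<le> h j x"
        unfolding h_def using V(2) y(3) by (intro cINF_greatest) auto
      moreover have "h j x \<le> f w x" by (rule h_le[OF V(2) y(3)])
      ultimately show ?thesis using e by simp
    qed
    then show "\<exists>J. \<forall>j\<ge>J. norm (h j x - f w x) < e" by blast
  qed
  have h_meas: "h j \<in> borel_measurable P" for j
    unfolding h_def using meas
    by (intro borel_measurable_INF_continuous bddE continuous_on_subset[OF cont]) auto
  have "(\<lambda>j. \<integral>x. h j x \<partial>P) \<longlonglongrightarrow> (\<integral>x. f w x \<partial>P)"
  proof (rule integral_dominated_convergence[OF meas[OF y(3)] h_meas \<zeta>])
    show "AE x in P. norm (h j x) \<le> \<zeta> x" for j
    proof (intro AE_I2)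
      fix x
      show "norm (h j x) \<le> \<zeta> x"
        using h_ge[of x j] h_le[OF V(2) y(3), of j x] bound[OF y(3), of x] by (simp add: abs_le_iff)
    qed
  qed (use h_lim in auto)
  then have lim: "(\<lambda>j. ereal (\<integral>x. h j x \<partial>P)) \<longlonglongrightarrow> ereal (\<integral>x. f w x \<partial>P)" by simp
  \<comment> \<open>For fixed \<open>j\<close> the points \<open>y k\<close> eventually enter
    \<open>V j\<close>, where \<open>h j\<close> is a minorant to which the law of large numbers
    applies. Only afterwards does \<open>j\<close> tend to infinity.\<close>
  have "ereal (\<integral>x. h j x \<partial>P) \<le> liminf (\<lambda>k. ereal (sample_average s (r k) (f (y k))))" for j
  proof -
    have "(\<lambda>N. sample_average s N (h j)) \<longlonglongrightarrow> (\<integral>x. h j x \<partial>P)"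
      using lln[OF V(1)[of j]] V(2)[of j] y(3) unfolding h_def by blast
    from LIMSEQ_subseq_LIMSEQ[OF this r]
    have "(\<lambda>k. ereal (sample_average s (r k) (h j))) \<longlonglongrightarrow> ereal (\<integral>x. h j x \<partial>P)"
      by (simp add: comp_def)
    then have "ereal (\<integral>x. h j x \<partial>P) = liminf (\<lambda>k. ereal (sample_average s (r k) (h j)))"
      by (intro lim_imp_Liminf[symmetric]) auto
    also have "\<dots> \<le> liminf (\<lambda>k. ereal (sample_average s (r k) (f (y k))))"
    proof (rule Liminf_mono)
      have "\<forall>\<^sub>F k in sequentially. y k \<in> V j"
        using topological_basis_open[OF base V(1)] V(2) by (intro topological_tendstoD[OF y(2)])
      then show "\<forall>\<^sub>F k in sequentially. ereal (sample_average s (r k) (h j)) \<le> ereal (sample_average s (r k) (f (y k)))"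
        using y(1) by eventually_elim (auto intro!: sample_average_mono h_le)
    qed
    finally show ?thesis .
  qed
  then show ?thesis using LIMSEQ_le_const2[OF lim] by blast
qed

text \<open>The deterministic half: \<open>s\<close> is one sample path, and probability enters only
  through the assumed limits of averages. An upper bound on the limsup of the optimal values meets a
  lower bound on their liminf along weakly convergent subsequences.\<close>

lemma sample_average_approximation_consistent:
  fixes B :: "'u::{real_inner, complete_space, second_countable_topology} \<Rightarrow> 'w::{real_normed_vector, second_countable_topology}"
    and \<psi> :: "'u \<Rightarrow> ereal" and P :: "'x measure"
  assumes B: "compact_operator B"
    and psi_nonneg: "\<And>u. \<psi> u \<ge> 0" and psi_proper: "proper_fun \<psi>"
    and psi_closed: "closed_fun \<psi>" and psi_convex: "convex_fun \<psi>" and psi_bdd: "bounded (effdom \<psi>)"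
    and cont: "\<And>x. continuous_on (B ` effdom \<psi>) (\<lambda>w. f w x)"
    and meas: "\<And>w. w \<in> B ` effdom \<psi> \<Longrightarrow> f w \<in> borel_measurable P"
    and bound: "\<And>w x. w \<in> B ` effdom \<psi> \<Longrightarrow> \<bar>f w x\<bar> \<le> \<zeta> x" and \<zeta>: "integrable P \<zeta>"
    and base: "topological_basis \<V>"
    and lln: "\<And>V. V \<in> \<V> \<Longrightarrow> V \<inter> B ` effdom \<psi> \<noteq> {} \<Longrightarrow>
      (\<lambda>N. sample_average s N (\<lambda>x. INF w\<in>V \<inter> B ` effdom \<psi>. f w x))
        \<longlonglongrightarrow> (\<integral>x. (INF w\<in>V \<inter> B ` effdom \<psi>. f w x) \<partial>P)"
    and lln_\<zeta>: "(\<lambda>N. sample_average s N \<zeta>) \<longlonglongrightarrow> (\<integral>x. \<zeta> x \<partial>P)"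
    and v_inf: "(INF k::nat. ereal (\<integral>x. f (B (v k)) x \<partial>P) + \<psi> (v k)) = (INF u. ereal (\<integral>x. f (B u) x \<partial>P) + \<psi> u)"
    and lln_v: "\<And>k. v k \<in> effdom \<psi> \<Longrightarrow>
      (\<lambda>N. sample_average s N (f (B (v k)))) \<longlonglongrightarrow> (\<integral>x. f (B (v k)) x \<partial>P)"
    and opt: "\<And>N u'. N \<ge> 1 \<Longrightarrow> ereal (sample_average s N (f (B (u N)))) + \<psi> (u N)
      \<le> ereal (sample_average s N (f (B u'))) + \<psi> u'"
  shows "(\<lambda>N. INF u'. ereal (sample_average s N (f (B u'))) + \<psi> u') \<longlonglongrightarrow> (INF u. ereal (\<integral>x. f (B u) x \<partial>P) + \<psi> u)"
    and "\<exists>x. weak_accumulation_point u x"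
    and "\<And>x. weak_accumulation_point u x \<Longrightarrow>
      ereal (\<integral>z. f (B x) z \<partial>P) + \<psi> x \<le> (INF u. ereal (\<integral>x. f (B u) x \<partial>P) + \<psi> u)"
proof -
  define G where "G u = ereal (\<integral>x. f (B u) x \<partial>P) + \<psi> u" for u
  define GN where "GN N u = ereal (sample_average s N (f (B u))) + \<psi> u" for N u
  define Z where "Z N = GN N (u N)" for N
  have INF_GN: "(INF u'. GN N u') = Z N" if "N \<ge> 1" for N
    unfolding Z_def by (rule antisym) (auto intro!: INF_lower INF_greatest opt[OF that] simp: GN_def)
  obtain v0 where v0: "v0 \<in> effdom \<psi>" using psi_proper by (auto simp: proper_fun_def effdom_def)
  then obtain p where p: "\<psi> v0 = ereal p"
    using psi_nonneg[of v0] by (cases "\<psi> v0") (auto simp: effdom_def)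
  have u_dom: "u N \<in> effdom \<psi>" if "N \<ge> 1" for N
    using opt[OF that, of v0] p by (cases "\<psi> (u N)") (auto simp: effdom_def)
  \<comment> \<open>Optimality is assumed from \<open>N = 1\<close> on, so \<open>u 0\<close> may
    lie outside the domain; one extra point does not affect boundedness.\<close>
  have "range u \<subseteq> insert (u 0) (effdom \<psi>)"
  proof (rule image_subsetI)
    show "u N \<in> insert (u 0) (effdom \<psi>)" for N using u_dom[of N] by (cases N) auto
  qed
  then have u_bdd: "bounded (range u)" using psi_bdd by (meson bounded_insert bounded_subset)
  then show "\<exists>x. weak_accumulation_point u x" using bounded_imp_weak_accumulation_point by blast

  \<comment> \<open>Comparing \<open>u N\<close> with the feasible point \<open>v0\<close> bounds
    \<open>\<psi> (u N)\<close> by \<open>p\<close> plus the difference of two averages, each at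
    most the average of \<open>\<zeta>\<close> in absolute value, which is eventually below its
    limit plus 1.\<close>
  define c where "c = 2 * ((\<integral>x. \<zeta> x \<partial>P) + 1) + p"
  have "\<forall>\<^sub>F N in sequentially. sample_average s N \<zeta> < (\<integral>x. \<zeta> x \<partial>P) + 1"
    by (rule order_tendstoD(2)[OF lln_\<zeta>]) simp
  then have psi_c: "\<forall>\<^sub>F N in sequentially. \<psi> (u N) \<le> ereal c"
    using eventually_ge_at_top[of 1]
  proof eventually_elim
    case (elim N)
    have "\<bar>sample_average s N (f (B (u N)))\<bar> \<le> sample_average s N \<zeta>"
      "\<bar>sample_average s N (f (B v0))\<bar> \<le> sample_average s N \<zeta>"
      using u_dom[OF elim(2)] v0 by (auto intro!: sample_average_abs_le bound)
    then show ?case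
      using opt[OF elim(2), of v0] elim(1) p by (cases "\<psi> (u N)") (auto simp: c_def)
  qed

  have upper: "limsup Z \<le> (INF u. G u)"
  proof -
    have "limsup Z \<le> G (v k)" for k
    proof (cases "v k \<in> effdom \<psi>")
      case True
      then obtain q where q: "\<psi> (v k) = ereal q"
        using psi_nonneg[of "v k"] by (cases "\<psi> (v k)") (auto simp: effdom_def)
      have "(\<lambda>N. sample_average s N (f (B (v k))) + q) \<longlonglongrightarrow> (\<integral>x. f (B (v k)) x \<partial>P) + q"
        by (intro tendsto_add tendsto_const lln_v True)
      then have "(\<lambda>N. GN N (v k)) \<longlonglongrightarrow> G (v k)" unfolding G_def GN_def q by simp
      then have "limsup (\<lambda>N. GN N (v k)) = G (v k)" by (intro lim_imp_Limsup) auto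
      moreover have "limsup Z \<le> limsup (\<lambda>N. GN N (v k))"
      proof (rule Limsup_mono)
        show "\<forall>\<^sub>F N in sequentially. Z N \<le> GN N (v k)"
          using eventually_ge_at_top[of 1] by eventually_elim (simp add: Z_def GN_def opt)
      qed
      ultimately show ?thesis by simp
    qed (auto simp: G_def effdom_def)
    then have "limsup Z \<le> (INF k. G (v k))" by (rule INF_greatest)
    then show ?thesis using v_inf by (simp add: G_def)
  qed

  have lower: "G x \<le> liminf (Z \<circ> r)" if r: "strict_mono r" and x: "weakly_converges (u \<circ> r) x" for r x
  proof -
    \<comment> \<open>The domain of \<open>\<psi>\<close> need not be closed, so membership in it
      alone would not pass to the weak limit; a sublevel set is closed and convex.\<close>
    have "\<forall>\<^sub>F k in sequentially. \<psi> ((u \<circ> r) k) \<le> ereal c"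
      using eventually_subseq[OF r psi_c] by simp
    then have "x \<in> {u. \<psi> u \<le> ereal c}"
      by (intro weak_limit_in_closed_convex[OF closed_sublevel convex_sublevel _ x]
          psi_closed psi_convex eventually_frequently) auto
    then have x_dom: "x \<in> effdom \<psi>" by (auto simp: effdom_def)
    have "bounded (range (u \<circ> r))" using u_bdd by (rule bounded_subset) auto
    then have "(\<lambda>k. B ((u \<circ> r) k)) \<longlonglongrightarrow> B x"
      by (rule compact_operator_weak_to_strong[OF B _ x])
    moreover have "\<forall>\<^sub>F k in sequentially. B ((u \<circ> r) k) \<in> B ` effdom \<psi>"
      using eventually_subseq[OF r eventually_ge_at_top[of 1]] by eventually_elim (simp add: u_dom)
    ultimately have 1: "ereal (\<integral>z. f (B x) z \<partial>P) \<le> liminf (\<lambda>k. ereal (sample_average s (r k) (f (B ((u \<circ> r) k)))))"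
      using x_dom by (intro liminf_sample_average_ge[OF cont meas bound \<zeta> base lln r]) auto
    have 2: "\<psi> x \<le> liminf (\<lambda>k. \<psi> ((u \<circ> r) k))"
      by (rule weakly_lsc[OF psi_closed psi_convex x])
    \<comment> \<open>Neither liminf is minus infinity, which makes superadditivity of liminf valid
      for extended reals.\<close>
    have "0 \<le> liminf (\<lambda>k. \<psi> ((u \<circ> r) k))" using 2 psi_nonneg[of x] by (rule order_trans[rotated])
    moreover have "liminf (\<lambda>k. ereal (sample_average s (r k) (f (B ((u \<circ> r) k))))) \<noteq> -\<infinity>" using 1 by auto
    ultimately have "liminf (\<lambda>k. ereal (sample_average s (r k) (f (B ((u \<circ> r) k))))) + liminf (\<lambda>k. \<psi> ((u \<circ> r) k))
      \<le> liminf (\<lambda>k. ereal (sample_average s (r k) (f (B ((u \<circ> r) k)))) + \<psi> ((u \<circ> r) k))"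
      by (intro ereal_liminf_add_mono) auto
    with add_mono[OF 1 2] show ?thesis
      by (auto simp: G_def Z_def GN_def comp_def)
  qed

  show "ereal (\<integral>z. f (B x) z \<partial>P) + \<psi> x \<le> (INF u. ereal (\<integral>x. f (B u) x \<partial>P) + \<psi> u)" if acc: "weak_accumulation_point u x" for x
  proof -
    obtain r where r: "strict_mono r" "weakly_converges (u \<circ> r) x"
      using acc by (auto simp: weak_accumulation_point_def)
    have "G x \<le> liminf (Z \<circ> r)" by (rule lower[OF r])
    also have "\<dots> \<le> limsup (Z \<circ> r)" by (rule Liminf_le_Limsup) simp
    also have "\<dots> \<le> limsup Z" by (rule limsup_subseq_mono[OF r(1)])
    finally show ?thesis using upper by (simp add: G_def)
  qed

  have "(INF u. G u) \<le> liminf Z"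
  proof -
    \<comment> \<open>The liminf is first realised along a subsequence; a weakly convergent further
      subsequence keeps the same limit of values.\<close>
    obtain r :: "nat \<Rightarrow> nat" where r: "strict_mono r" "(Z \<circ> r) \<longlonglongrightarrow> liminf Z"
      using liminf_subseq_lim[of Z] by blast
    have "bounded (range (u \<circ> r))" using u_bdd by (rule bounded_subset) auto
    then obtain x t where t: "strict_mono t" "weakly_converges (u \<circ> r \<circ> t) x"
      using bounded_imp_weak_accumulation_point unfolding weak_accumulation_point_def by blast
    have "(INF u. G u) \<le> G x" by (rule INF_lower) simp
    also have "\<dots> \<le> liminf (Z \<circ> (r \<circ> t))"
      using t r(1) by (intro lower) (auto simp: comp_assoc intro: strict_mono_o)
    also have "\<dots> = liminf Z"
      using LIMSEQ_subseq_LIMSEQ[OF r(2) t(1)] by (intro lim_imp_Liminf) (auto simp: comp_assoc)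
    finally show ?thesis .
  qed
  moreover have "liminf Z \<le> limsup Z" by (rule Liminf_le_Limsup) simp
  ultimately have "Z \<longlonglongrightarrow> (INF u. G u)" using upper by (intro Liminf_eq_Limsup) auto
  moreover have "\<forall>\<^sub>F N in sequentially. Z N = (INF u'. GN N u')"
    using eventually_ge_at_top[of 1] by eventually_elim (simp add: INF_GN)
  ultimately have "(\<lambda>N. INF u'. GN N u') \<longlonglongrightarrow> (INF u. G u)" by (rule Lim_transform_eventually)
  then show "(\<lambda>N. INF u'. ereal (sample_average s N (f (B u'))) + \<psi> u') \<longlonglongrightarrow> (INF u. ereal (\<integral>x. f (B u) x \<partial>P) + \<psi> u)"
    by (simp add: G_def GN_def)
qed

text \<open>The strong law is applied to \<open>g\<close> composed with the samples, renumbered from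
  0 by \<open>Suc\<close>; the change of variables formula turns the expectation into an integral
  over \<open>P\<close>.\<close>

lemma (in prob_space) AE_sample_average_tendsto:
  fixes Y :: "nat \<Rightarrow> 'a \<Rightarrow> 'x::topological_space"
  assumes indep: "indep_vars (\<lambda>_. borel) Y {1..}"
    and distr: "\<And>i. i \<ge> 1 \<Longrightarrow> distr M borel (Y i) = P"
    and g: "integrable P g"
  shows "AE \<omega> in M. (\<lambda>N. sample_average (\<lambda>i. Y i \<omega>) N g) \<longlonglongrightarrow> (\<integral>x. g x \<partial>P)"
proof -
  have Y: "Y (Suc i) \<in> M \<rightarrow>\<^sub>M borel" for i
    using indep unfolding indep_vars_def by simp
  have P: "distr M borel (Y (Suc i)) = P" for i by (rule distr) simp
  have sets_P: "sets P = sets borel" by (simp flip: P[of 0])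
  then have g_meas: "g \<in> borel_measurable borel"
    using borel_measurable_integrable[OF g] measurable_cong_sets by blast
  have range: "range Suc = {1..}" by (auto simp: image_iff Suc_le_eq gr0_conv_Suc)
  have "AE \<omega> in M. (\<lambda>n. (\<Sum>i<n. g (Y (Suc i) \<omega>)) / n) \<longlonglongrightarrow> expectation (\<lambda>\<omega>. g (Y (Suc 0) \<omega>))"
  proof (rule strong_law_of_large_numbers)
    have "indep_vars (\<lambda>_. borel) (\<lambda>i. Y (Suc i)) UNIV"
      by (rule indep_vars_inj_reindex) (use indep range in auto)
    then show "indep_vars (\<lambda>_. borel) (\<lambda>i \<omega>. g (Y (Suc i) \<omega>)) UNIV"
      by (rule indep_vars_compose2) (use g_meas in simp)
    have "distr M borel (\<lambda>\<omega>. g (Y (Suc i) \<omega>)) = distr P borel g" for i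
      unfolding P[of i, symmetric] by (subst distr_distr) (use g_meas Y in \<open>auto simp: comp_def\<close>)
    then show "distr M borel (\<lambda>\<omega>. g (Y (Suc i) \<omega>)) = distr M borel (\<lambda>\<omega>. g (Y (Suc 0) \<omega>))" for i
      by simp
    show "integrable M (\<lambda>\<omega>. g (Y (Suc 0) \<omega>))"
      using g integrable_distr_eq[OF Y g_meas] P by simp
  qed
  moreover have "expectation (\<lambda>\<omega>. g (Y (Suc 0) \<omega>)) = (\<integral>x. g x \<partial>P)"
    unfolding P[of 0, symmetric] by (rule integral_distr[OF Y g_meas, symmetric])
  moreover have "(\<Sum>i<n. g (Y (Suc i) \<omega>)) / n = sample_average (\<lambda>i. Y i \<omega>) n g" for n \<omega>
    by (simp add: sample_average_def sum.atLeast1_atMost_eq)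
  ultimately show ?thesis by simp
qed

section \<open>Almost sure consistency for independent samples\<close>

theorem theorem3p5:
  fixes B :: "'u::{real_inner, complete_space, second_countable_topology} \<Rightarrow> 'w::{banach, second_countable_topology}"
    and \<psi> :: "'u \<Rightarrow> ereal"
    and U0 :: "'u set"
    and M :: "'o measure"
    and \<xi> :: "'o \<Rightarrow> 'x::polish_space"
    and \<xi>s :: "nat \<Rightarrow> 'o \<Rightarrow> 'x"
    and f :: "'w \<Rightarrow> 'x \<Rightarrow> real"
    and \<zeta> :: "'x \<Rightarrow> real"
    and uN :: "nat \<Rightarrow> 'o \<Rightarrow> 'u"
  assumes B: "compact_operator B"
    and psi_nonneg: "\<And>u. \<psi> u \<ge> 0"
    and psi_proper: "proper_fun \<psi>"
    and psi_closed: "closed_fun \<psi>"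
    and psi_convex: "convex_fun \<psi>"
    and psi_dom_bounded: "bounded (effdom \<psi>)"
    and U0: "open U0" "convex U0" "bounded U0" "effdom \<psi> \<subseteq> U0"
    and M: "prob_space M" "complete_measure M"
    and xi_meas: "\<xi> \<in> M \<rightarrow>\<^sub>M borel"
    and xis_meas: "\<And>i. i \<ge> 1 \<Longrightarrow> \<xi>s i \<in> M \<rightarrow>\<^sub>M borel"
    and xis_indep: "prob_space.indep_vars M (\<lambda>_. borel) \<xi>s {1..}"
    and xis_distr: "\<And>i. i \<ge> 1 \<Longrightarrow> distr M borel (\<xi>s i) = distr M borel \<xi>"
    and f_cont: "\<And>x. continuous_on (B ` effdom \<psi>) (\<lambda>w. f w x)"
    and f_meas: "\<And>w. w \<in> B ` U0 \<Longrightarrow> (\<lambda>x. f w x) \<in> borel_measurable borel"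
    and f_bound: "\<And>u x. u \<in> U0 \<Longrightarrow> \<bar>f (B u) x\<bar> \<le> \<zeta> x"
    and zeta_nonneg: "\<And>x. \<zeta> x \<ge> 0"
    and zeta_int: "integrable (distr M borel \<xi>) \<zeta>"
    and uN_meas: "\<And>N. N \<ge> 1 \<Longrightarrow> uN N \<in> M \<rightarrow>\<^sub>M borel"
    and uN_opt: "\<And>N \<omega> v. N \<ge> 1 \<Longrightarrow> \<omega> \<in> space M \<Longrightarrow>
        ereal ((1 / real N) * (\<Sum>i=1..N. f (B (uN N \<omega>)) (\<xi>s i \<omega>))) + \<psi> (uN N \<omega>)
        \<le> ereal ((1 / real N) * (\<Sum>i=1..N. f (B v) (\<xi>s i \<omega>))) + \<psi> v"
  shows
    "(AE \<omega> in M. (\<lambda>N. INF u. ereal ((1 / real N) * (\<Sum>i=1..N. f (B u) (\<xi>s i \<omega>))) + \<psi> u)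
        \<longlonglongrightarrow> (INF u. ereal (\<integral>x. f (B u) x \<partial>distr M borel \<xi>) + \<psi> u))
   \<and>
    (AE \<omega> in M. (\<exists>u. weak_accumulation_point (\<lambda>N. uN N \<omega>) u) \<and>
        (\<forall>u. weak_accumulation_point (\<lambda>N. uN N \<omega>) u \<longrightarrow>
           (\<forall>v. ereal (\<integral>x. f (B u) x \<partial>distr M borel \<xi>) + \<psi> u
                \<le> ereal (\<integral>x. f (B v) x \<partial>distr M borel \<xi>) + \<psi> v)))"
proof -
  interpret prob_space M by (rule M)
  define P where "P = distr M borel \<xi>"
  define E where "E = B ` effdom \<psi>"
  define G where "G u = ereal (\<integral>x. f (B u) x \<partial>P) + \<psi> u" for u
  have meas_P: "measurable P borel = borel_measurable borel"
    unfolding P_def by (rule measurable_distr_eq1)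
  have \<zeta>: "integrable P \<zeta>" using zeta_int by (simp add: P_def)
  have meas: "f w \<in> borel_measurable P" if "w \<in> E" for w
    using f_meas[of w] that U0(4) by (auto simp: E_def meas_P)
  have bound: "\<bar>f w x\<bar> \<le> \<zeta> x" if "w \<in> E" for w x
    using f_bound that U0(4) by (auto simp: E_def)
  have lln: "AE \<omega> in M. (\<lambda>N. sample_average (\<lambda>i. \<xi>s i \<omega>) N g) \<longlonglongrightarrow> (\<integral>x. g x \<partial>P)" if "integrable P g" for g
    using xis_distr by (intro AE_sample_average_tendsto[OF xis_indep _ that]) (simp add: P_def)

  obtain \<V> :: "'w set set" where \<V>: "countable \<V>" "topological_basis \<V>"
    using ex_countable_basis by blast
  \<comment> \<open>Nonemptiness matters: one point of the set carries the upper bound by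
    \<open>\<zeta>\<close> over to the infimum.\<close>
  have int_INF: "integrable P (\<lambda>x. INF w\<in>V \<inter> E. f w x)" if ne: "V \<inter> E \<noteq> {}" for V
  proof (rule Bochner_Integration.integrable_bound[OF \<zeta>])
    have ge: "- \<zeta> x \<le> f w x" if "w \<in> E" for w x using bound[OF that, of x] by linarith
    then have bdd: "bdd_below ((\<lambda>w. f w x) ` (V \<inter> E))" for x
      by (intro bdd_belowI[of _ "- \<zeta> x"]) auto
    then show "(\<lambda>x. INF w\<in>V \<inter> E. f w x) \<in> borel_measurable P"
      using meas
      by (intro borel_measurable_INF_continuous continuous_on_subset[OF f_cont[folded E_def]]) auto
    obtain w where w: "w \<in> V \<inter> E" using ne by blast
    have "\<bar>INF w\<in>V \<inter> E. f w x\<bar> \<le> \<zeta> x" for x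
    proof -
      have "(INF w\<in>V \<inter> E. f w x) \<le> f w x" by (rule cINF_lower[OF bdd w])
      moreover have "- \<zeta> x \<le> (INF w\<in>V \<inter> E. f w x)" using ne ge by (intro cINF_greatest) auto
      moreover have "f w x \<le> \<zeta> x" using bound[of w x] w by auto
      ultimately show ?thesis by (simp add: abs_le_iff)
    qed
    then show "AE x in P. norm (INF w\<in>V \<inter> E. f w x) \<le> norm (\<zeta> x)"
      using zeta_nonneg by (intro AE_I2) simp
  qed
  have ae_V: "AE \<omega> in M. \<forall>V\<in>{V\<in>\<V>. V \<inter> E \<noteq> {}}.
    (\<lambda>N. sample_average (\<lambda>i. \<xi>s i \<omega>) N (\<lambda>x. INF w\<in>V \<inter> E. f w x)) \<longlonglongrightarrow> (\<integral>x. (INF w\<in>V \<inter> E. f w x) \<partial>P)"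
    using \<V>(1) by (subst AE_ball_countable) (auto intro: lln int_INF)
  have ae_\<zeta>: "AE \<omega> in M. (\<lambda>N. sample_average (\<lambda>i. \<xi>s i \<omega>) N \<zeta>) \<longlonglongrightarrow> (\<integral>x. \<zeta> x \<partial>P)"
    by (rule lln[OF \<zeta>])
  \<comment> \<open>A countable family attaining the infimum in the limit confines the law of large
    numbers to countably many points, without presupposing a minimiser of \<open>G\<close>.\<close>
  obtain v :: "nat \<Rightarrow> 'u" where v: "(INF k. G (v k)) = (INF u. G u)"
  proof -
    obtain \<phi> :: "nat \<Rightarrow> ereal" where \<phi>: "range \<phi> \<subseteq> range G" "(INF u. G u) = (INF k. \<phi> k)"
      using Inf_countable_INF[of "range G"] by auto
    then have "\<forall>k. \<exists>u. \<phi> k = G u" by blast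
    then obtain v where "\<And>k. \<phi> k = G (v k)" by metis
    then show thesis using \<phi>(2) that[of v] by simp
  qed
  have ae_v: "AE \<omega> in M. \<forall>k. v k \<in> effdom \<psi> \<longrightarrow>
    (\<lambda>N. sample_average (\<lambda>i. \<xi>s i \<omega>) N (f (B (v k)))) \<longlonglongrightarrow> (\<integral>x. f (B (v k)) x \<partial>P)"
  proof (subst AE_all_countable, intro allI)
    fix k
    show "AE \<omega> in M. v k \<in> effdom \<psi> \<longrightarrow>
      (\<lambda>N. sample_average (\<lambda>i. \<xi>s i \<omega>) N (f (B (v k)))) \<longlonglongrightarrow> (\<integral>x. f (B (v k)) x \<partial>P)"
    proof (cases "v k \<in> effdom \<psi>")
      case True
      then have w: "B (v k) \<in> E" by (auto simp: E_def)
      have "integrable P (f (B (v k)))"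
        using bound[OF w] zeta_nonneg
        by (intro Bochner_Integration.integrable_bound[OF \<zeta> meas[OF w]] AE_I2) auto
      then show ?thesis using lln by auto
    qed simp
  qed
  have "AE \<omega> in M.
    ((\<lambda>N. INF u. ereal (sample_average (\<lambda>i. \<xi>s i \<omega>) N (f (B u))) + \<psi> u) \<longlonglongrightarrow> (INF u. G u)) \<and>
    (\<exists>u. weak_accumulation_point (\<lambda>N. uN N \<omega>) u) \<and>
    (\<forall>u. weak_accumulation_point (\<lambda>N. uN N \<omega>) u \<longrightarrow> G u \<le> (INF u. G u))"
    using ae_V ae_\<zeta> ae_v AE_space
  proof eventually_elim
    case (elim \<omega>)
    have opt: "ereal (sample_average (\<lambda>i. \<xi>s i \<omega>) N (f (B (uN N \<omega>)))) + \<psi> (uN N \<omega>)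
      \<le> ereal (sample_average (\<lambda>i. \<xi>s i \<omega>) N (f (B u'))) + \<psi> u'" if "N \<ge> 1" for N u'
      unfolding sample_average_def by (rule uN_opt[OF that elim(4)])
    have lln_V: "(\<lambda>N. sample_average (\<lambda>i. \<xi>s i \<omega>) N (\<lambda>x. INF w\<in>V \<inter> E. f w x))
      \<longlonglongrightarrow> (\<integral>x. (INF w\<in>V \<inter> E. f w x) \<partial>P)" if "V \<in> \<V>" "V \<inter> E \<noteq> {}" for V
      using elim(1) that by blast
    note consistent = sample_average_approximation_consistent[where f = f and P = P and s = "\<lambda>i. \<xi>s i \<omega>"
        and u = "\<lambda>N. uN N \<omega>" and v = v,
        OF B psi_nonneg psi_proper psi_closed psi_convex psi_dom_bounded f_cont,
        folded E_def G_def, OF meas bound \<zeta> \<V>(2) lln_V elim(2) v elim(3)[rule_format] opt]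
    show ?case using consistent by blast
  qed
  then have main: "AE \<omega> in M.
    ((\<lambda>N. INF u. ereal ((1 / real N) * (\<Sum>i=1..N. f (B u) (\<xi>s i \<omega>))) + \<psi> u) \<longlonglongrightarrow> (INF u. G u)) \<and>
    (\<exists>u. weak_accumulation_point (\<lambda>N. uN N \<omega>) u) \<and>
    (\<forall>u. weak_accumulation_point (\<lambda>N. uN N \<omega>) u \<longrightarrow> (\<forall>v. G u \<le> G v))"
    unfolding sample_average_def
  proof eventually_elim
    case (elim \<omega>)
    then show ?case using order_trans[OF _ INF_lower[of _ UNIV G]] by simp
  qed
  show ?thesis
    unfolding P_def[symmetric] G_def[symmetric]
  proof
    show "AE \<omega> in M. (\<lambda>N. INF u. ereal ((1 / real N) * (\<Sum>i=1..N. f (B u) (\<xi>s i \<omega>))) + \<psi> u) \<longlonglongrightarrow> (INF u. G u)"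
      using main by eventually_elim simp
    show "AE \<omega> in M. (\<exists>u. weak_accumulation_point (\<lambda>N. uN N \<omega>) u) \<and>
        (\<forall>u. weak_accumulation_point (\<lambda>N. uN N \<omega>) u \<longrightarrow> (\<forall>v. G u \<le> G v))"
      using main by eventually_elim simp
  qed
qed

end
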